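(* Let $k\ge 1$ be an integer and let $n=4k+16$, the order of the graph $H(k)$. Then $\gamma_{1,2}(H(k))=n/2+3$.
   Context: All graphs are finite and simple. A set $S\subseteq V(G)$ is a $(1,2)$-dominating set of a graph $G$ if every vertex outside $S$ has at least one neighbour in $S$ and every vertex of $S$ has at least two neighbours in $S$. $\gamma_{1,2}(G)$ is the smallest size of a $(1,2)$-dominating set of $G$. For an integer $k\ge 1$, the graph $H(k)$ has the $16+4k$ distinct vertices $a_1,a_2$; $u^j_i$ ($1\le j\le 3$, $0\le i\le k+1$; $j$ is a superscript index); $m_i$ ($1\le i\le k$); $v_1,v_2,v_3$; $z_1,z_2,z_3$; $b_1,b_2$. Its edges are: $a_1u^j_0$ and $a_2u^j_0$ for $1\le j\le 3$; $u^j_{i-1}u^j_i$ for $1\le j\le 3$ and $1\le i\le k+1$; $m_iu^j_i$ for $1\le j\le 3$ and $1\le i\le k$; the triangle edges $u^1_{k+1}u^2_{k+1}$, $u^1_{k+1}v_1$, $u^2_{k+1}v_1$; the triangle edges $u^3_{k+1}v_2$, $u^3_{k+1}v_3$, $v_2v_3$; $v_jz_j$ for $1\le j\le 3$; $b_1z_j$ and $b_2z_j$ for $1\le j\le 3$. *)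

theory Defs
  imports Complex_Main "Graph_Theory.Pair_Digraph"
begin

text \<open>
  A finite simple graph is a \<^locale>\<open>pair_graph\<close>: a finite, symmetric, loop-free
  digraph without parallel arcs, each undirected edge $xy$ being represented by the two
  arcs $(x,y)$ and $(y,x)$.
\<close>

definition neighbours :: "'a pair_pre_digraph \<Rightarrow> 'a \<Rightarrow> 'a set" where
  "neighbours G v = {u. (v, u) \<in> parcs G}"

definition dominating_1_2 :: "'a pair_pre_digraph \<Rightarrow> 'a set \<Rightarrow> bool" where
  "dominating_1_2 G S \<longleftrightarrow>
     S \<subseteq> pverts G \<and>
     (\<forall>v \<in> pverts G - S. card (neighbours G v \<inter> S) \<ge> 1) \<and>
     (\<forall>v \<in> S. card (neighbours G v \<inter> S) \<ge> 2)"

text \<open>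
  The value is unspecified if the graph has no $(1,2)$-dominating set; for the graphs below,
  the whole vertex set is one (\<open>dominating_1_2_H\<close>).
\<close>

definition gamma_1_2 :: "'a pair_pre_digraph \<Rightarrow> nat" where
  "gamma_1_2 G = (LEAST s. \<exists>S. dominating_1_2 G S \<and> card S = s)"

text \<open>\<open>U j i\<close> stands for $u^j_i$.\<close>

datatype vertex = A nat | U nat nat | M nat | V nat | Z nat | B nat

definition H_verts :: "nat \<Rightarrow> vertex set" where
  "H_verts k =
     {A 1, A 2}
     \<union> {U j i | j i. j \<in> {1..3} \<and> i \<in> {0..k+1}}
     \<union> {M i | i. i \<in> {1..k}}
     \<union> {V 1, V 2, V 3}
     \<union> {Z 1, Z 2, Z 3}
     \<union> {B 1, B 2}"

text \<open>One orientation of each edge; \<open>H\<close> adds the opposite arcs.\<close>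

definition H_edges :: "nat \<Rightarrow> vertex rel" where
  "H_edges k =
     {(A 1, U j 0) | j. j \<in> {1..3}}
     \<union> {(A 2, U j 0) | j. j \<in> {1..3}}
     \<union> {(U j (i - 1), U j i) | j i. j \<in> {1..3} \<and> i \<in> {1..k+1}}
     \<union> {(M i, U j i) | j i. j \<in> {1..3} \<and> i \<in> {1..k}}
     \<union> {(U 1 (k+1), U 2 (k+1)), (U 1 (k+1), V 1), (U 2 (k+1), V 1)}
     \<union> {(U 3 (k+1), V 2), (U 3 (k+1), V 3), (V 2, V 3)}
     \<union> {(V j, Z j) | j. j \<in> {1..3}}
     \<union> {(B 1, Z j) | j. j \<in> {1..3}}
     \<union> {(B 2, Z j) | j. j \<in> {1..3}}"

definition H :: "nat \<Rightarrow> vertex pair_pre_digraph" where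
  "H k = \<lparr> pverts = H_verts k, parcs = H_edges k \<union> (H_edges k)\<inverse> \<rparr>"

lemma finite_H_verts: "finite (H_verts k)"
proof -
  have "{U j i | j i. j \<in> {1..3} \<and> i \<in> {0..k+1}} = (\<lambda>(j, i). U j i) ` ({1..3} \<times> {0..k+1})"
    by auto
  then show ?thesis by (simp add: H_verts_def)
qed

lemma in_H_verts:
  "A c \<in> H_verts k \<longleftrightarrow> c \<in> {1..2}"
  "U j i \<in> H_verts k \<longleftrightarrow> j \<in> {1..3} \<and> i \<le> k + 1"
  "M i \<in> H_verts k \<longleftrightarrow> i \<in> {1..k}"
  "V j \<in> H_verts k \<longleftrightarrow> j \<in> {1..3}"
  "Z j \<in> H_verts k \<longleftrightarrow> j \<in> {1..3}"
  "B c \<in> H_verts k \<longleftrightarrow> c \<in> {1..2}"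
  by (simp_all add: H_verts_def, presburger+)

lemma H_edges_subset: "H_edges k \<subseteq> H_verts k \<times> H_verts k"
  unfolding H_edges_def by (auto simp: in_H_verts)

lemma pair_graph_H: "pair_graph (H k)"
proof
  show "fst e \<in> pverts (H k)" if "e \<in> parcs (H k)" for e
    using that H_edges_subset[of k] by (auto simp: H_def)
  show "snd e \<in> pverts (H k)" if "e \<in> parcs (H k)" for e
    using that H_edges_subset[of k] by (auto simp: H_def)
  show "finite (pverts (H k))"
    by (simp add: H_def finite_H_verts)
  show "finite (parcs (H k))"
    using finite_subset[OF H_edges_subset[of k]] by (simp add: H_def finite_H_verts)
  show "fst e \<noteq> snd e" if "e \<in> parcs (H k)" for e
    using that by (auto simp: H_def H_edges_def)
  show "symmetric (H k)"
    by (simp add: symmetric_def H_def sym_Un_converse)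
qed

lemma dominating_1_2_H:
  "dominating_1_2 (H k) (pverts (H k))"
proof -
  interpret pair_graph "H k" by (rule pair_graph_H)
  have two: "card (neighbours (H k) v \<inter> pverts (H k)) \<ge> 2"
    if "(v, x) \<in> parcs (H k)" "(v, y) \<in> parcs (H k)" "x \<noteq> y" for v x y
  proof -
    have "{x, y} \<subseteq> neighbours (H k) v \<inter> pverts (H k)"
      using that by (auto simp: neighbours_def dest: in_arcsD2)
    then have "card {x, y} \<le> card (neighbours (H k) v \<inter> pverts (H k))"
      by (intro card_mono) (simp_all add: pair_finite_verts)
    then show ?thesis using that(3) by simp
  qed
  have arcA: "(A c, U j 0) \<in> H_edges k" if "c \<in> {1..2}" "j \<in> {1..3}" for c j
  proof -
    have "c = 1 \<or> c = 2" using that by auto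
    then show ?thesis using that(2) by (auto simp: H_edges_def)
  qed
  have arcB: "(B c, Z j) \<in> H_edges k" if "c \<in> {1..2}" "j \<in> {1..3}" for c j
  proof -
    have "c = 1 \<or> c = 2" using that by auto
    then show ?thesis using that(2) by (auto simp: H_edges_def)
  qed
  have arcU: "(U j i, U j (Suc i)) \<in> H_edges k" if "j \<in> {1..3}" "i \<le> k" for j i
  proof -
    have "(U j (Suc i - 1), U j (Suc i)) \<in>
        {(U j (i - 1), U j i) | j i. j \<in> {1..3} \<and> i \<in> {1..k+1}}"
      using that by (intro CollectI exI[of _ j] exI[of _ "Suc i"]) simp
    then show ?thesis unfolding H_edges_def by simp
  qed
  have arcM: "(M i, U j i) \<in> H_edges k" if "j \<in> {1..3}" "i \<in> {1..k}" for j i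
    using that by (simp add: H_edges_def)
  have arcVZ: "(V j, Z j) \<in> H_edges k" if "j \<in> {1..3}" for j
    using that by (simp add: H_edges_def)
  have arcUV: "(U 1 (k+1), V 1) \<in> H_edges k" "(U 2 (k+1), V 1) \<in> H_edges k"
    "(U 3 (k+1), V 2) \<in> H_edges k" "(U 3 (k+1), V 3) \<in> H_edges k"
    by (simp_all add: H_edges_def)
  have fwd: "(x, y) \<in> parcs (H k)" and bwd: "(y, x) \<in> parcs (H k)"
    if "(x, y) \<in> H_edges k" for x y
    using that by (simp_all add: H_def)
  have "\<exists>x y. (v, x) \<in> parcs (H k) \<and> (v, y) \<in> parcs (H k) \<and> x \<noteq> y"
    if v: "v \<in> H_verts k" for v
  proof (cases v)
    case (A c)
    then have "(v, U 1 0) \<in> parcs (H k)" "(v, U 2 0) \<in> parcs (H k)"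
      using v by (simp_all add: in_H_verts fwd arcA)
    then show ?thesis by fastforce
  next
    case (U j i)
    then have ji: "j \<in> {1..3}" "i \<le> k + 1" using v by (simp_all add: in_H_verts)
    show ?thesis
    proof (cases i)
      case 0
      then have "(v, A 1) \<in> parcs (H k)" "(v, A 2) \<in> parcs (H k)"
        using U ji by (simp_all add: bwd arcA)
      then show ?thesis by fastforce
    next
      case (Suc i')
      have 1: "(v, U j i') \<in> parcs (H k)"
        using U ji Suc by (simp add: bwd arcU)
      show ?thesis
      proof (cases "i = k + 1")
        case True
        have "j = 1 \<or> j = 2 \<or> j = 3" using ji by auto
        then have "\<exists>l. (v, V l) \<in> parcs (H k)"
          using U True fwd[OF arcUV(1)] fwd[OF arcUV(2)] fwd[OF arcUV(3)] by blast
        with 1 show ?thesis by fastforce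
      next
        case False
        then have "(v, M i) \<in> parcs (H k)"
          using U ji Suc by (simp add: bwd arcM)
        with 1 show ?thesis by fastforce
      qed
    qed
  next
    case (M i)
    then have "(v, U 1 i) \<in> parcs (H k)" "(v, U 2 i) \<in> parcs (H k)"
      using v by (simp_all add: in_H_verts fwd arcM)
    then show ?thesis by fastforce
  next
    case (V j)
    then have j: "j \<in> {1..3}" using v by (simp add: in_H_verts)
    then have 1: "(v, Z j) \<in> parcs (H k)" using V by (simp add: fwd arcVZ)
    have "j = 1 \<or> j = 2 \<or> j = 3" using j by auto
    then have "\<exists>l. (v, U l (k+1)) \<in> parcs (H k)"
      using V bwd[OF arcUV(1)] bwd[OF arcUV(3)] bwd[OF arcUV(4)] by blast
    with 1 show ?thesis by fastforce
  next
    case (Z j)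
    then have "(v, B 1) \<in> parcs (H k)" "(v, B 2) \<in> parcs (H k)"
      using v by (simp_all add: in_H_verts bwd arcB)
    then show ?thesis by fastforce
  next
    case (B c)
    then have "(v, Z 1) \<in> parcs (H k)" "(v, Z 2) \<in> parcs (H k)"
      using v by (simp_all add: in_H_verts fwd arcB)
    then show ?thesis by fastforce
  qed
  then have "card (neighbours (H k) v \<inter> pverts (H k)) \<ge> 2" if "v \<in> pverts (H k)" for v
    using two that by (metis H_def pair_pre_digraph.select_convs(1))
  then show ?thesis by (simp add: dominating_1_2_def)
qed

end

theory Submission
  imports Defs
begin

text \<open>
  Write $x_v \in \{0, 1\}$ for the indicator of $v \in S$. A set $S$ is $(1,2)$-dominating exactly
  if $1 + x_v \le \sum_{u \sim v} x_u$ for every vertex $v$, so the number sought is the optimum of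
  an integer program with one inequality per vertex, and $H(k)$ is a long narrow strip: layer $i$
  consists of the three vertices $u^j_i$ and, for $1 \le i \le k$, of $m_i$; the vertices
  $a_1$ and $a_2$ are counted to layer $0$.

  \<^bold>\<open>Lower bound.\<close> Let $p_i$ be the number of chosen $u^j_i$ in layer $i$. Adding the inequalities
  of the three $u^j_i$ forgets the columns and leaves
  $3 + p_i \le p_{i-1} + p_{i+1} + 3 x_{m_i}$, while $m_i$ contributes $1 + x_{m_i} \le p_i$.
  These two inequalities already force two chosen vertices per layer on average. The fluctuation
  around this average is controlled by a potential depending on $(p_i, p_{i+1})$ only: the layers
  $0, \dots, i$ contain at least $2i$ plus that potential many vertices of $S$
  (\<open>prefix_bound\<close>). The part of the graph beyond layer $k$ contains at least $11$ minus the potential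
  of $(p_k, p_{k+1})$ many (\<open>potential_end\<close>), so $2k + 11 = n/2 + 3$ vertices are needed. Only at
  this end do the individual columns matter.

  \<^bold>\<open>Upper bound.\<close> In every column take runs of three consecutive vertices separated by gaps of
  three, the three columns being shifted against each other by two, and take $m_i$ at the layers
  where runs begin and end. Such layers cost three and alternate with layers of cost one. A shift
  depending on $k$ makes the pattern end in the same way for every $k$ of a given parity, so that
  one completion at the right end serves each parity, and the two differ in one vertex only.
\<close>

section \<open>Domination as a system of inequalities\<close>

definition ind :: "'a set \<Rightarrow> 'a \<Rightarrow> nat" where
  "ind S v = of_bool (v \<in> S)"

lemma dominating_1_2_iff_ind_sum:
  assumes "pair_graph G"
  shows "dominating_1_2 G S \<longleftrightarrow> S \<subseteq> pverts G \<and>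
    (\<forall>v \<in> pverts G. 1 + ind S v \<le> (\<Sum>u \<in> neighbours G v. ind S u))"
proof -
  interpret pair_graph G by fact
  have "finite (neighbours G v)" for v
    by (rule finite_subset[OF _ pair_finite_verts]) (auto simp: neighbours_def dest: in_arcsD2)
  then have "(\<Sum>u \<in> neighbours G v. ind S u) = card (neighbours G v \<inter> S)" for v
    by (simp add: ind_def of_bool_def sum.If_cases)
  then show ?thesis
    by (auto simp: dominating_1_2_def ind_def numeral_2_eq_2)
qed

section \<open>The strip structure of the graph\<close>

lemma dominating_H_iff:
  "dominating_1_2 (H k) S \<longleftrightarrow> S \<subseteq> H_verts k \<and>
    (\<forall>v \<in> H_verts k. 1 + ind S v \<le> (\<Sum>u \<in> neighbours (H k) v. ind S u))"
  using dominating_1_2_iff_ind_sum[OF pair_graph_H[of k], of S] by (simp add: H_def)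

lemma in_1_to_3: "j \<in> {1..3::nat} \<longleftrightarrow> j = 1 \<or> j = 2 \<or> j = 3"
  by auto

lemma neighbours_H:
  "c \<in> {1..2} \<Longrightarrow> neighbours (H k) (A c) = {U 1 0, U 2 0, U 3 0}"
  "j \<in> {1..3} \<Longrightarrow> neighbours (H k) (U j 0) = {A 1, A 2, U j 1}"
  "j \<in> {1..3} \<Longrightarrow> i \<in> {1..k} \<Longrightarrow>
     neighbours (H k) (U j i) = {U j (i - 1), U j (i + 1), M i}"
  "i \<in> {1..k} \<Longrightarrow> neighbours (H k) (M i) = {U 1 i, U 2 i, U 3 i}"
  "neighbours (H k) (U 1 (k+1)) = {U 1 k, U 2 (k+1), V 1}"
  "neighbours (H k) (U 2 (k+1)) = {U 2 k, U 1 (k+1), V 1}"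
  "neighbours (H k) (U 3 (k+1)) = {U 3 k, V 2, V 3}"
  "neighbours (H k) (V 1) = {U 1 (k+1), U 2 (k+1), Z 1}"
  "neighbours (H k) (V 2) = {U 3 (k+1), V 3, Z 2}"
  "neighbours (H k) (V 3) = {U 3 (k+1), V 2, Z 3}"
  "j \<in> {1..3} \<Longrightarrow> neighbours (H k) (Z j) = {V j, B 1, B 2}"
  "c \<in> {1..2} \<Longrightarrow> neighbours (H k) (B c) = {Z 1, Z 2, Z 3}"
  unfolding neighbours_def H_def H_edges_def pair_pre_digraph.simps in_1_to_3
             apply (auto; linarith)[1]
             apply auto[11]
  done

definition layer :: "vertex set \<Rightarrow> nat \<Rightarrow> nat" where
  "layer S i = ind S (U 1 i) + ind S (U 2 i) + ind S (U 3 i)"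

lemma sum_1_to_3: "(\<Sum>j = 1..3. f j) = f 1 + f 2 + (f (3::nat) :: nat)"
  by (simp add: numeral_3_eq_3 numeral_2_eq_2)

lemma sum_H_verts:
  "sum f (H_verts k) = f (A 1) + f (A 2) + (\<Sum>i = 0..k+1. \<Sum>j = 1..3. f (U j i))
    + (\<Sum>i = 1..k. f (M i))
    + (\<Sum>j = 1..3. f (V j)) + (\<Sum>j = 1..3. f (Z j)) + f (B 1) + (f (B 2) :: nat)"
proof -
  let ?U = "(\<lambda>(i, j). U j i) ` ({0..k+1} \<times> {1..3})"
  have eq: "H_verts k = {A 1, A 2} \<union> (?U \<union> (M ` {1..k} \<union> (V ` {1..3} \<union> (Z ` {1..3} \<union> {B 1, B 2}))))"
    unfolding H_verts_def by (auto simp: in_1_to_3)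
  have "sum f ?U = (\<Sum>i = 0..k+1. \<Sum>j = 1..3. f (U j i))"
    by (subst sum.reindex) (auto simp: inj_on_def sum.cartesian_product case_prod_beta)
  moreover have "sum f (H_verts k) = sum f {A 1, A 2} + (sum f ?U + (sum f (M ` {1..k}) +
      (sum f (V ` {1..3}) + (sum f (Z ` {1..3}) + sum f {B 1, B 2}))))"
    unfolding eq by (subst sum.union_disjoint, simp, simp, force)+ (rule refl)
  ultimately show ?thesis by (simp add: sum.reindex inj_on_def)
qed

text \<open>
  The sum is grouped by layers: each summand of the sum over $i$ is one middle layer, which is the
  step of the induction in the lower bound.
\<close>

lemma card_by_layers:
  assumes "S \<subseteq> H_verts k"
  shows "card S = ind S (A 1) + ind S (A 2) + layer S 0 + (\<Sum>i = 1..k. ind S (M i) + layer S i)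
    + layer S (k+1) + (ind S (V 1) + ind S (V 2) + ind S (V 3))
    + (ind S (Z 1) + ind S (Z 2) + ind S (Z 3)) + ind S (B 1) + ind S (B 2)"
proof -
  have "card S = card (H_verts k \<inter> S)" using assms by (simp add: Int_absorb1)
  also have "\<dots> = sum (ind S) (H_verts k)"
    using finite_H_verts[of k] by (simp add: ind_def of_bool_def sum.If_cases)
  also have "\<dots> = ind S (A 1) + ind S (A 2) + layer S 0 + (\<Sum>i = 1..k. ind S (M i) + layer S i)
    + layer S (k+1) + (ind S (V 1) + ind S (V 2) + ind S (V 3))
    + (ind S (Z 1) + ind S (Z 2) + ind S (Z 3)) + ind S (B 1) + ind S (B 2)"
    unfolding sum_H_verts sum_1_to_3 layer_def by (simp add: sum.distrib sum.atLeast_Suc_atMost)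
  finally show ?thesis .
qed

section \<open>The lower bound\<close>

text \<open>
  If layers $i$ and $i + 1$ contain $p$ and $q$ chosen $u$-vertices, this is a lower bound for what
  the layers $0, \dots, i$ with $i \ge 1$ have spent beyond $2i$. The main part is $p + 2$. One more
  vertex must have been spent if the prefix gets little help from layer $i + 1$: if all of layer
  $i$ is chosen but nothing follows, or if one vertex of layer $i$ is followed by at most one. One
  vertex may have been saved if the whole of layer $i + 1$ supports a layer with two chosen
  vertices.
\<close>

definition potential :: "nat \<Rightarrow> nat \<Rightarrow> nat" where
  "potential p q = p + 2 + of_bool (p = 3 \<and> q = 0) + of_bool (p = 1 \<and> q \<le> 1)
     - of_bool (p = 2 \<and> q = 3)"

text \<open>
  The invariant passes from layer $i$, with $p$ chosen, to layer $i + 1$, with $q$ chosen and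
  $m = x_{m_{i+1}}$: the rise of the potential plus two is paid by the $m + q$ new vertices.
  The hypotheses are the column inequalities of layer $i + 1$, added up, and that of $m_{i+1}$.
\<close>

lemma potential_step:
  assumes "p + r + 3 * m \<ge> 3 + q" "1 \<le> p" "1 + m \<le> q" "p \<le> 3" "q \<le> 3" "r \<le> 3" "m \<le> 1"
  shows "potential q r + 2 \<le> potential p q + m + q"
proof -
  have "p \<in> {1,2,3}" "q \<in> {1,2,3}" "r \<in> {0,1,2,3}" "m \<in> {0,1}" using assms by auto
  then show ?thesis using assms(1,3) unfolding potential_def
    by (elim insertE emptyE; simp)
qed

text \<open>
  The invariant starts at layer $1$ because it can fail at layer $0$: for $a = 1$ and $p = q = 2$
  layer $0$ contains three vertices of $S$, but the potential is $4$.
  Here $a$ counts the chosen ones among $a_1, a_2$, and the numbers $p$, $q$, $r$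
  belong to layers $0$, $1$, $2$.
\<close>

lemma potential_base:
  assumes "a \<in> {1, 2}" "p \<in> {2, 3}" "3 + p \<le> 3 * a + q"
    and "3 + q \<le> p + r + 3 * m" "1 + m \<le> q" "q \<le> 3" "r \<le> 3" "m \<le> 1"
  shows "2 + potential q r \<le> a + p + m + q"
proof -
  have "q \<in> {1,2,3}" "r \<in> {0,1,2,3}" "m \<in> {0,1}"
    using assms by auto
  with assms(1,2) show ?thesis using assms(3-5) unfolding potential_def
    by (elim insertE emptyE; simp)
qed

text \<open>
  Here \<open>p i\<close> stands for the number of chosen $u^j_i$, \<open>m i\<close> for the indicator of $m_i$, and $a_1$,
  $a_2$ for the indicators of the vertices with these names.
\<close>

lemma prefix_bound:
  fixes p m :: "nat \<Rightarrow> nat"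
  assumes le: "\<And>i. p i \<le> 3" "\<And>i. m i \<le> 1" "a1 \<le> 1" "a2 \<le> 1"
    and a: "1 + a1 \<le> p 0" "1 + a2 \<le> p 0"
    and u0: "3 + p 0 \<le> 3 * (a1 + a2) + p 1"
    and u: "\<And>i. i \<in> {1..k} \<Longrightarrow> 3 + p i \<le> p (i - 1) + p (i + 1) + 3 * m i"
    and m: "\<And>i. i \<in> {1..k} \<Longrightarrow> 1 + m i \<le> p i"
    and "1 \<le> i" "i \<le> k"
  shows "2 * i + potential (p i) (p (i + 1)) \<le> a1 + a2 + p 0 + (\<Sum>l = 1..i. m l + p l)"
  using \<open>1 \<le> i\<close> \<open>i \<le> k\<close>
proof (induction i rule: nat_induct_at_least)
  case base
  have "2 + potential (p 1) (p 2) \<le> a1 + a2 + p 0 + m 1 + p 1"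
  proof -
    have "a1 + a2 \<in> {1, 2}" "p 0 \<in> {2, 3}" using le(1)[of 0] le(1)[of 1] le(3,4) a u0 by auto
    then show ?thesis using le u0 u[of 1] m[of 1] base
      by (intro potential_base[of _ _ "p 1" "p 2" "m 1"]) (simp_all add: numeral_2_eq_2)
  qed
  then show ?case by (simp add: numeral_2_eq_2)
next
  case (Suc i)
  have "potential (p (i + 1)) (p (i + 2)) + 2 \<le> potential (p i) (p (i + 1)) + m (i + 1) + p (i + 1)"
    using le u[of "i + 1"] m[of "i + 1"] m[of i] Suc by (intro potential_step) simp_all
  then show ?case using Suc by simp
qed

text \<open>
  The right end, with $x$ for layer $k$, $y$ for layer $k + 1$, and $v$, $z$, $b$ as in the graph.
  Layer $k$ enters through its number of chosen vertices and, in the inequalities of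
  layer $k + 1$, through its columns. The last hypothesis records how a single chosen vertex of
  layer $k$ is supported: then $m_k$ is not chosen, so its second chosen neighbour lies in layer
  $k + 1$.
\<close>

lemma potential_end:
  fixes x y v z :: "nat \<Rightarrow> nat"
  assumes le: "x 1 \<le> 1" "x 2 \<le> 1" "x 3 \<le> 1" "y 1 \<le> 1" "y 2 \<le> 1" "y 3 \<le> 1"
    "v 1 \<le> 1" "v 2 \<le> 1" "v 3 \<le> 1" "z 1 \<le> 1" "z 2 \<le> 1" "z 3 \<le> 1" "b1 \<le> 1" "b2 \<le> 1"
  and u: "1 + y 1 \<le> x 1 + y 2 + v 1" "1 + y 2 \<le> x 2 + y 1 + v 1" "1 + y 3 \<le> x 3 + v 2 + v 3"
  and v: "1 + v 1 \<le> y 1 + y 2 + z 1" "1 + v 2 \<le> y 3 + v 3 + z 2" "1 + v 3 \<le> y 3 + v 2 + z 3"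
  and z: "1 + z 1 \<le> v 1 + b1 + b2" "1 + z 2 \<le> v 2 + b1 + b2" "1 + z 3 \<le> v 3 + b1 + b2"
  and b: "1 + b1 \<le> z 1 + z 2 + z 3" "1 + b2 \<le> z 1 + z 2 + z 3"
  and p: "1 \<le> x 1 + x 2 + x 3"
   "x 1 + x 2 + x 3 = 1 \<Longrightarrow> x 1 \<le> y 1 \<and> x 2 \<le> y 2 \<and> x 3 \<le> y 3"
  shows "11 \<le> potential (x 1 + x 2 + x 3) (y 1 + y 2 + y 3) +
    (y 1 + y 2 + y 3) + (v 1 + v 2 + v 3) + (z 1 + z 2 + z 3) + b1 + b2"
proof -
  let ?P = "x 1 + x 2 + x 3" let ?Q = "y 1 + y 2 + y 3" let ?N = "v 1 + v 2 + v 3"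
  let ?Z = "z 1 + z 2 + z 3"
  have b_pos: "b1 + b2 \<ge> 1" using z b le by linarith
  have Z2: "?Z \<ge> 2" using b b_pos by linarith
  \<comment> \<open>With a single chosen \<open>b\<close>, each chosen \<open>z j\<close> needs its neighbour \<open>v j\<close> as well.\<close>
  have b_cases: "b1 + b2 = 2 \<or> b1 + b2 = 1 \<and> z 1 \<le> v 1 \<and> z 2 \<le> v 2 \<and> z 3 \<le> v 3"
    using z b_pos le by linarith
  \<comment> \<open>Without the third column, \<open>v 2\<close> and \<open>v 3\<close> can only be dominated by \<open>z 2\<close> and \<open>z 3\<close> and,
    if chosen, by each other.\<close>
  have y3: "y 3 = 0 \<and> v 2 = v 3 \<and> z 2 = 1 \<and> z 3 = 1 \<or> y 3 = 1"
    using le v by linarith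
  consider "?P = 1" | "?P = 2" | "?P = 3" using le p by linarith
  \<comment> \<open>In each case the bound claimed is 11 minus the potential.\<close>
  then show ?thesis
  proof cases
    case 1
    have "?Q + ?N + ?Z + b1 + b2 \<ge> (if ?Q \<le> 1 then 7 else 8)"
    proof (cases "x 3 = 0")
      case True
      then have "v 1 = 1" "1 \<le> y 1 + y 2" "1 + y 3 \<le> v 2 + v 3"
        using 1 p(2) u le by linarith+
      then show ?thesis using b_cases y3 Z2 v(1) le by auto
    next
      case False
      then have "x 3 = 1" "x 1 = 0" "x 2 = 0" using 1 le by linarith+
      then have "v 1 = 1" "y 3 = 1" "1 \<le> v 2 + v 3" "y 1 = 1" "y 2 = 1"
        using 1 p(2) u v(1) le by linarith+
      then show ?thesis using b_pos Z2 by simp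
    qed
    then show ?thesis using 1 by (simp add: potential_def split: if_splits)
  next
    case 2
    have "?Q + ?N + ?Z + b1 + b2 \<ge> (if ?Q \<le> 2 then 7 else 8)"
    proof (cases "b1 + b2 = 2")
      case b: True
      show ?thesis
      proof (cases "y 3 = 0")
        case True
        \<comment> \<open>If \<open>v 1 = v 2 = v 3 = 0\<close>, then each column of layer \<open>k\<close> has to be chosen.\<close>
        then have "v 1 \<noteq> 0 \<or> v 2 \<noteq> 0" using u y3 2 by linarith
        then show ?thesis using b True v y3 le by auto
      next
        case False
        have "2 - x 3 \<le> v 2 + v 3" using u False by linarith
        moreover have "x 3 = 1 \<Longrightarrow> v 1 = 1" using u 2 le by linarith
        ultimately have "2 \<le> v 1 + v 2 + v 3" using le by linarith
        then show ?thesis using b False Z2 by simp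
      qed
    next
      case False
      then have zv: "z 1 \<le> v 1" "z 2 \<le> v 2" "z 3 \<le> v 3" and b: "b1 + b2 = 1" using b_cases by auto
      show ?thesis
      proof (cases "y 3 = 0")
        case True
        have "y 1 = 1 \<and> y 2 = 1" if "v 1 = 0" using that u v(1) zv(1) 2 le by linarith
        moreover have "v 2 = 1" "v 3 = 1" "z 2 = 1" "z 3 = 1" using True y3 zv le by linarith+
        ultimately show ?thesis using b True v zv le by (cases "v 1 = 0") auto
      next
        case False
        then have "y 3 = 1" "1 \<le> y 1 + y 2" using y3 v(1) zv(1) by linarith+
        then show ?thesis using b zv Z2 by simp
      qed
    qed
    then show ?thesis using 2 le by (simp add: potential_def split: if_splits)
  next
    case 3
    have "?Q + ?N + ?Z + b1 + b2 \<ge> (if ?Q = 0 then 5 else 6)"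
    proof (cases "b1 + b2 = 2 \<and> ?N = 0")
      case True
      \<comment> \<open>In all other configurations the \<open>v\<close>, \<open>z\<close> and \<open>b\<close> alone number at least five. In this one
        \<open>y 1 + y 2 + y 3\<close> is even, so it is 0 or 2; if it is 0, all \<open>z\<close> are needed.\<close>
      then have "y 1 = y 2" "y 3 = 0" using u 3 le by linarith+
      then show ?thesis using True y3 v Z2 by auto
    next
      case False
      then show ?thesis using b_cases Z2 by auto
    qed
    then show ?thesis using 3 by (simp add: potential_def split: if_splits)
  qed
qed

lemma lower_bound:
  assumes "1 \<le> k" "dominating_1_2 (H k) S"
  shows "2 * k + 11 \<le> card S"
proof -
  have S: "S \<subseteq> H_verts k" and
    dom: "\<And>v. v \<in> H_verts k \<Longrightarrow> 1 + ind S v \<le> (\<Sum>u \<in> neighbours (H k) v. ind S u)"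
    using assms(2) by (auto simp: dominating_H_iff)
  define x where "x = ind S"
  have x_le_1: "x v \<le> 1" for v
    by (simp add: x_def ind_def)
  have domA: "1 + x (A c) \<le> layer S 0" if "c \<in> {1..2}" for c
    using dom[of "A c"] that by (simp add: neighbours_H in_H_verts layer_def x_def)
  have domU0: "1 + x (U j 0) \<le> x (A 1) + x (A 2) + x (U j 1)" if "j \<in> {1..3}" for j
    using dom[of "U j 0"] that by (simp add: neighbours_H in_H_verts x_def)
  have domU: "1 + x (U j i) \<le> x (U j (i - 1)) + x (U j (i + 1)) + x (M i)"
    if "j \<in> {1..3}" "i \<in> {1..k}" for j i
  proof -
    have "i - 1 \<noteq> i + 1" by simp
    then show ?thesis using dom[of "U j i"] that
      by (simp add: neighbours_H(3) in_H_verts x_def)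
  qed
  have domM: "1 + x (M i) \<le> layer S i" if "i \<in> {1..k}" for i
    using dom[of "M i"] that by (simp add: neighbours_H in_H_verts layer_def x_def)
  have layer_le_3: "layer S i \<le> 3" for i
    using x_le_1[of "U 1 i"] x_le_1[of "U 2 i"] x_le_1[of "U 3 i"]
    by (simp add: layer_def x_def)
  have pre: "2 * k + potential (layer S k) (layer S (k + 1))
      \<le> x (A 1) + x (A 2) + layer S 0 + (\<Sum>i = 1..k. x (M i) + layer S i)"
  proof (rule prefix_bound[where m = "\<lambda>i. x (M i)" and k = k])
    show "3 + layer S 0 \<le> 3 * (x (A 1) + x (A 2)) + layer S 1"
      using domU0[of 1] domU0[of 2] domU0[of 3] by (simp add: layer_def x_def)
    show "3 + layer S i \<le> layer S (i - 1) + layer S (i + 1) + 3 * x (M i)" if "i \<in> {1..k}" for i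
      using domU[of 1 i] domU[of 2 i] domU[of 3 i] that by (simp add: layer_def x_def)
  qed (use assms(1) layer_le_3 x_le_1 domA domM in auto)
  have "11 \<le> potential (x (U 1 k) + x (U 2 k) + x (U 3 k))
        (x (U 1 (k+1)) + x (U 2 (k+1)) + x (U 3 (k+1)))
      + (x (U 1 (k+1)) + x (U 2 (k+1)) + x (U 3 (k+1))) + (x (V 1) + x (V 2) + x (V 3))
      + (x (Z 1) + x (Z 2) + x (Z 3)) + x (B 1) + x (B 2)"
  proof (rule potential_end[where x = "\<lambda>j. x (U j k)" and y = "\<lambda>j. x (U j (k+1))"
        and v = "\<lambda>j. x (V j)" and z = "\<lambda>j. x (Z j)"])
    show "1 \<le> x (U 1 k) + x (U 2 k) + x (U 3 k)"
      using domM[of k] assms(1) by (simp add: layer_def x_def)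
    assume "x (U 1 k) + x (U 2 k) + x (U 3 k) = 1"
    then have "x (M k) = 0"
      using domM[of k] assms(1) by (simp add: layer_def x_def)
    then have "x (U j k) \<le> x (U j (k+1))" if "j \<in> {1..3}" for j
      using domU[of j k] x_le_1[of "U j (k - 1)"] that assms(1) by simp
    then show "x (U 1 k) \<le> x (U 1 (k+1)) \<and> x (U 2 k) \<le> x (U 2 (k+1)) \<and> x (U 3 k) \<le> x (U 3 (k+1))"
      by simp
  next
    show "1 + x (U 1 (k+1)) \<le> x (U 1 k) + x (U 2 (k+1)) + x (V 1)"
      "1 + x (U 2 (k+1)) \<le> x (U 2 k) + x (U 1 (k+1)) + x (V 1)"
      "1 + x (U 3 (k+1)) \<le> x (U 3 k) + x (V 2) + x (V 3)"
      "1 + x (V 1) \<le> x (U 1 (k+1)) + x (U 2 (k+1)) + x (Z 1)"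
      "1 + x (V 2) \<le> x (U 3 (k+1)) + x (V 3) + x (Z 2)"
      "1 + x (V 3) \<le> x (U 3 (k+1)) + x (V 2) + x (Z 3)"
      using dom[of "U 1 (k+1)"] dom[of "U 2 (k+1)"] dom[of "U 3 (k+1)"]
        dom[of "V 1"] dom[of "V 2"] dom[of "V 3"]
      unfolding neighbours_H x_def by (simp_all add: in_H_verts)
    show "1 + x (Z 1) \<le> x (V 1) + x (B 1) + x (B 2)" "1 + x (Z 2) \<le> x (V 2) + x (B 1) + x (B 2)"
      "1 + x (Z 3) \<le> x (V 3) + x (B 1) + x (B 2)"
      "1 + x (B 1) \<le> x (Z 1) + x (Z 2) + x (Z 3)" "1 + x (B 2) \<le> x (Z 1) + x (Z 2) + x (Z 3)"
      using dom[of "Z 1"] dom[of "Z 2"] dom[of "Z 3"] dom[of "B 1"] dom[of "B 2"]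
      by (simp_all add: neighbours_H in_H_verts x_def)
  qed (rule x_le_1)+
  then show ?thesis
    using pre card_by_layers[OF S] by (simp add: layer_def x_def)
qed

section \<open>An optimal dominating set\<close>

text \<open>
  The residue of the index modulo six cuts every column into runs and gaps of length three. The
  summand $2j$ shifts the columns against each other, the constant makes runs begin and end at odd
  layers (so that an even layer of a run is its middle), and the summand with $k$ places the
  end: layer $k + 1$ contains a run vertex of column 3, and one of column 2 if $k$ is even, but none
  of column 1 (\<open>run_end\<close>).
\<close>

definition in_run :: "nat \<Rightarrow> nat \<Rightarrow> nat \<Rightarrow> bool" where
  "in_run k j i \<longleftrightarrow> (i + 2 * j + 4 * ((k + 1) div 2) + 1) mod 6 < 3"

text \<open>
  Continuing the pattern to the even layer $0$ would leave $a_2$ with a single chosen neighbour;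
  repeating layer $1$ there gives it two and supports each chosen $u^j_1$ besides $m_1$.
  The vertex $u^1_{k+1}$, which lies in no run, is part of the completion at the right end.
\<close>

definition run_set :: "nat \<Rightarrow> vertex set" where
  "run_set k = {A 2}
     \<union> {U j i | j i. j \<in> {1..3} \<and> i \<in> {0..k+1} \<and> in_run k j (max 1 i)} \<union> {U 1 (k+1)}
     \<union> {M i | i. i \<in> {1..k} \<and> odd i}
     \<union> {V 1, V 2, Z 1, Z 2, B 1}"

lemma run_set_subset: "run_set k \<subseteq> H_verts k"
  by (auto simp: run_set_def in_H_verts)

text \<open>
  The domination inequality inside a column, with \<open>odd i\<close> for the indicator of $m_i$. The middle of
  a run has both column neighbours, an end of a run has one of them and $m_i$. In a gap, the middle
  has only $m_i$, and the other two vertices have the adjacent run.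
\<close>

lemma run_domination:
  assumes "1 \<le> i"
  shows "1 + of_bool (in_run k j i)
    \<le> of_bool (in_run k j (i - 1)) + of_bool (in_run k j (i + 1)) + (of_bool (odd i) :: nat)"
proof -
  define c where "c = i + 2 * j + 4 * ((k + 1) div 2)"
  have "odd i \<longleftrightarrow> odd c" by (simp add: c_def)
  moreover have "1 + of_bool ((c + 1) mod 6 < 3)
      \<le> of_bool (c mod 6 < 3) + of_bool ((c + 2) mod 6 < 3) + (of_bool (odd c) :: nat)"
    unfolding of_bool_def by presburger
  moreover have "i - 1 + 2 * j + 4 * ((k + 1) div 2) + 1 = c"
    "i + 1 + 2 * j + 4 * ((k + 1) div 2) + 1 = c + 2"
    using assms by (simp_all add: c_def)
  ultimately show ?thesis
    unfolding in_run_def c_def[symmetric] by simp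
qed

text \<open>
  At an even layer one column is in the middle of its run; at an odd layer one run ends and
  another one begins.
\<close>

lemma run_layer:
  "of_bool (in_run k 1 i) + of_bool (in_run k 2 i) + of_bool (in_run k 3 i) = 1 + i mod 2"
proof -
  define c where "c = i + 4 * ((k + 1) div 2)"
  have "i mod 2 = c mod 2" unfolding c_def by presburger
  moreover have "of_bool ((c + 3) mod 6 < 3) + of_bool ((c + 5) mod 6 < 3)
      + of_bool ((c + 7) mod 6 < 3) = 1 + c mod 2"
    unfolding of_bool_def by presburger
  ultimately show ?thesis by (simp add: in_run_def c_def add_ac)
qed

lemma run_end:
  assumes "j \<in> {1..3}"
  shows "in_run k j (k + 1) \<longleftrightarrow> j = 3 \<or> j = 2 \<and> even k"
    and "in_run k j k \<longleftrightarrow> j = 3 \<or> j = 1 \<and> odd k"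
proof -
  have j: "j = 1 \<or> j = 2 \<or> j = 3" using assms by auto
  show "in_run k j (k + 1) \<longleftrightarrow> j = 3 \<or> j = 2 \<and> even k"
    using j unfolding in_run_def by (cases "even k"; elim evenE oddE disjE; simp; presburger)
  show "in_run k j k \<longleftrightarrow> j = 3 \<or> j = 1 \<and> odd k"
    using j unfolding in_run_def by (cases "even k"; elim evenE oddE disjE; simp; presburger)
qed

lemma ind_run_set:
  "ind (run_set k) (A c) = of_bool (c = 2)"
  "j \<in> {1..3} \<Longrightarrow> i \<le> k \<Longrightarrow> ind (run_set k) (U j i) = of_bool (in_run k j (max 1 i))"
  "j \<in> {1..3} \<Longrightarrow> ind (run_set k) (U j (k+1)) = of_bool (j \<noteq> 2 \<or> even k)"
  "i \<in> {1..k} \<Longrightarrow> ind (run_set k) (M i) = of_bool (odd i)"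
  "ind (run_set k) (V j) = of_bool (j = 1 \<or> j = 2)"
  "ind (run_set k) (Z j) = of_bool (j = 1 \<or> j = 2)"
  "ind (run_set k) (B c) = of_bool (c = 1)"
  using run_end(1)[of j k] by (auto simp: ind_def run_set_def in_1_to_3)

lemma layer_run_set:
  "i \<le> k \<Longrightarrow> layer (run_set k) i = 1 + max 1 i mod 2"
  "layer (run_set k) (k+1) = 2 + of_bool (even k)"
proof -
  show "i \<le> k \<Longrightarrow> layer (run_set k) i = 1 + max 1 i mod 2"
    using run_layer[of k "max 1 i"] by (simp add: layer_def ind_run_set(2))
  show "layer (run_set k) (k+1) = 2 + of_bool (even k)"
    unfolding layer_def by (subst (1 2 3) ind_run_set(3)) simp_all
qed

lemma card_run_set: "card (run_set k) = 2 * k + 11"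
proof -
  have "(\<Sum>i = 1..k. ind (run_set k) (M i) + layer (run_set k) i) = (\<Sum>i = 1..k. 1 + 2 * (i mod 2))"
    by (intro sum.cong refl) (auto simp: ind_run_set layer_run_set max_def odd_iff_mod_2_eq_one)
  also have "\<dots> = 2 * k + k mod 2"
    by (induction k) (simp_all, presburger)
  finally have "(\<Sum>i = 1..k. ind (run_set k) (M i) + layer (run_set k) i) = 2 * k + k mod 2" .
  moreover have "k mod 2 + of_bool (even k) = 1" by (cases "even k") (simp_all add: odd_iff_mod_2_eq_one)
  moreover have "layer (run_set k) 0 = 2" using layer_run_set(1)[of 0 k] by simp
  ultimately show ?thesis
    unfolding card_by_layers[OF run_set_subset] layer_run_set(2)
    by (simp add: ind_run_set)
qed

lemma dominating_run_set:
  assumes "1 \<le> k"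
  shows "dominating_1_2 (H k) (run_set k)"
proof -
  have "1 + ind (run_set k) v \<le> (\<Sum>u \<in> neighbours (H k) v. ind (run_set k) u)"
    if v: "v \<in> H_verts k" for v
  proof (cases v)
    case (A c)
    then show ?thesis using v layer_run_set(1)[of 0 k]
      by (simp add: in_H_verts neighbours_H ind_run_set(1) layer_def)
  next
    case (U j i)
    then have j: "j \<in> {1..3}" and "i \<le> k + 1" using v by (simp_all add: in_H_verts)
    then consider "i = 0" | "i \<in> {1..k}" | "i = k + 1" by fastforce
    then show ?thesis
    proof cases
      case 1
      then show ?thesis using U j assms by (simp add: neighbours_H ind_run_set)
    next
      case 2
      have eq: "(\<Sum>u \<in> neighbours (H k) v. ind (run_set k) u) = ind (run_set k) (U j (i - 1))
          + ind (run_set k) (U j (i + 1)) + of_bool (odd i)"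
      proof -
        have "i - 1 \<noteq> i + 1" by simp
        then show ?thesis using U j 2 by (simp add: neighbours_H(3) ind_run_set)
      qed
      \<comment> \<open>Only an inequality, as \<open>u^1_{k+1}\<close> is chosen without being in a run.\<close>
      have right: "of_bool (in_run k j (i + 1)) \<le> ind (run_set k) (U j (i + 1))"
        using j 2 by (auto simp: ind_def run_set_def)
      show ?thesis
      proof (cases "i = 1")
        case True
        then show ?thesis using eq U j 2 by (simp add: ind_run_set)
      next
        case False
        then have max: "max 1 i = i" "max 1 (i - 1) = i - 1" and "i \<le> k" "i - 1 \<le> k"
          using 2 by auto
        then show ?thesis
          using eq right run_domination[of i k j] U 2 ind_run_set(2)[OF j \<open>i \<le> k\<close>, unfolded max]
            ind_run_set(2)[OF j \<open>i - 1 \<le> k\<close>, unfolded max]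
          by simp
      qed
    next
      case 3
      have "max 1 k = k" using assms by simp
      moreover have "j = 1 \<or> j = 2 \<or> j = 3" using j by auto
      ultimately show ?thesis unfolding U 3
        using run_end(2)[of 1 k] run_end(2)[of 2 k] run_end(2)[of 3 k]
        by (elim disjE; simp only: neighbours_H)
          (simp_all add: ind_run_set[unfolded Suc_eq_plus1[symmetric]])
    qed
  next
    case (M i)
    then show ?thesis using v layer_run_set(1)[of i k]
      by (auto simp: in_H_verts neighbours_H ind_run_set(4) layer_def max_def
          odd_iff_mod_2_eq_one)
  next
    case (V j)
    then have "j = 1 \<or> j = 2 \<or> j = 3" using v by (auto simp: in_H_verts)
    then show ?thesis unfolding V
      by (elim disjE; simp only: neighbours_H)
        (simp_all add: ind_run_set[unfolded Suc_eq_plus1[symmetric]])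
  next
    case (Z j)
    then show ?thesis using v by (auto simp: in_H_verts neighbours_H ind_run_set)
  next
    case (B c)
    then show ?thesis using v by (simp add: in_H_verts neighbours_H ind_run_set)
  qed
  then show ?thesis using run_set_subset by (simp add: dominating_H_iff)
qed

theorem theorem11:
  fixes k n :: nat
  assumes "k \<ge> 1" and "n = 4 * k + 16"
  shows "card (pverts (H k)) = n \<and> real (gamma_1_2 (H k)) = real n / 2 + 3"
proof
  have "(\<Sum>i = 1..k. ind (H_verts k) (M i) + layer (H_verts k) i) = (\<Sum>i = 1..k. 4)"
    by (intro sum.cong refl) (simp add: ind_def layer_def in_H_verts)
  then show "card (pverts (H k)) = n"
    using card_by_layers[of "H_verts k" k] assms(2)
    by (simp add: H_def ind_def layer_def in_H_verts)
  have "gamma_1_2 (H k) = 2 * k + 11"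
    unfolding gamma_1_2_def
  proof (rule Least_equality)
    show "\<exists>S. dominating_1_2 (H k) S \<and> card S = 2 * k + 11"
      using dominating_run_set[OF assms(1)] card_run_set by blast
    show "2 * k + 11 \<le> s" if "\<exists>S. dominating_1_2 (H k) S \<and> card S = s" for s
      using that lower_bound[OF assms(1)] by blast
  qed
  then show "real (gamma_1_2 (H k)) = real n / 2 + 3"
    using assms(2) by simp
qed

end
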